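(* Let $f$ be a weakly generic 2-ribbon developable surface in $C^{1,2,1}([a,b],\mathbb R^3)$, and consider an isometric deformation $\gamma$ of $f$. Denote by $\alpha(t)$ the angle between $\Delta f_0(t)$ and $\Delta f_1(t)$ (along the deformation, this angle depends on the deformation parameter $\lambda$). Let $t_0\in[a,b]$ and let the parameter $\lambda$ of $\gamma$ be chosen such that $\cos(\alpha(t_0))$ depends linearly on $\lambda$. Then for every $t\in[a,b]$ the value $\cos(\alpha(t))$ depends linearly on $\lambda$.
   Context: A 2-ribbon surface is a mapping $f:[a,b]\times\{0,1,2\}\to\mathbb R^3$, $(t,i)\mapsto f_i(t)$; $\Delta f_i=f_{i+1}-f_i$; a dot denotes $\partial/\partial t$; $\langle\cdot,\cdot\rangle$ is the scalar product, $(x,y,z)$ the mixed (triple) product. $C^{1,2,1}([a,b],\mathbb R^3)$ is the Banach space of 2-ribbon surfaces with $f_0,f_2$ of class $C^1$ and $f_1$ of class $C^2$. $f$ is weakly generic if $(\dot f_1,\Delta f_0,\Delta f_1)\ne0$ for every $t\in[a,b]$. $f$ is developable if for every $t$ and $i=0,1$ the vectors $\dot f_i,\Delta f_i,\dot f_{i+1}$ are linearly dependent. Two surfaces $f,g$ are isometric if $|\dot f_i|=|\dot g_i|$, $|\Delta f_i|=|\Delta g_i|$, $\langle\dot f_i,\Delta f_{i-1}\rangle=\langle\dot g_i,\Delta g_{i-1}\rangle$, $\langle\dot f_i,\Delta f_i\rangle=\langle\dot g_i,\Delta g_i\rangle$, $\langle\dot f_i,\dot f_{i+1}\rangle=\langle\dot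 g_i,\dot g_{i+1}\rangle$ for all admissible $i,t$. A deformation of $f$ is a family $\{f^\lambda\}$, $\lambda\in[-\Lambda,\Lambda]$, $\Lambda>0$, with $f^0=f$, continuously differentiable in $\lambda$; it is isometric if all its members are isometric to each other. "Depends linearly on $\lambda$" means: is of the form $c_0+c_1\lambda$ with $c_0,c_1$ independent of $\lambda$. *)

theory Defs
  imports "HOL-Analysis.Analysis"
begin

text \<open>
  A 2-ribbon surface is represented by \<open>f :: nat \<Rightarrow> real \<Rightarrow> real^3\<close>, with \<open>f i t\<close> standing for
  \<open>f\<^sub>i(t)\<close>. Only the values at \<open>i \<in> {0,1,2}\<close> and \<open>t \<in> {a..b}\<close> are meaningful, and every notion
  below depends on these values only; in particular all derivatives are taken within \<open>{a..b}\<close>,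
  hence are one-sided at the endpoints.
\<close>

type_synonym ribbon_surface = "nat \<Rightarrow> real \<Rightarrow> real^3"

definition dot :: "real \<Rightarrow> real \<Rightarrow> ribbon_surface \<Rightarrow> nat \<Rightarrow> real \<Rightarrow> real^3" where
  "dot a b f i t = vector_derivative (f i) (at t within {a..b})"

definition Delta :: "ribbon_surface \<Rightarrow> nat \<Rightarrow> real \<Rightarrow> real^3" where
  "Delta f i t = f (Suc i) t - f i t"

primrec Ck_on :: "nat \<Rightarrow> real set \<Rightarrow> (real \<Rightarrow> 'a::real_normed_vector) \<Rightarrow> bool" where
  "Ck_on 0 S g \<longleftrightarrow> continuous_on S g"
| "Ck_on (Suc k) S g \<longleftrightarrow>
     (\<exists>g'. (\<forall>t\<in>S. (g has_vector_derivative g' t) (at t within S)) \<and> Ck_on k S g')"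

definition C121 :: "real \<Rightarrow> real \<Rightarrow> ribbon_surface set" where
  "C121 a b = {f. Ck_on 1 {a..b} (f 0) \<and> Ck_on 2 {a..b} (f 1) \<and> Ck_on 1 {a..b} (f 2)}"

definition mixed_product :: "real^3 \<Rightarrow> real^3 \<Rightarrow> real^3 \<Rightarrow> real" where
  "mixed_product x y z = x \<bullet> cross3 y z"

definition weakly_generic :: "real \<Rightarrow> real \<Rightarrow> ribbon_surface \<Rightarrow> bool" where
  "weakly_generic a b f \<longleftrightarrow>
     (\<forall>t\<in>{a..b}. mixed_product (dot a b f 1 t) (Delta f 0 t) (Delta f 1 t) \<noteq> 0)"

text \<open>
  Linear dependence of the family \<open>(x, y, z)\<close>. The library's \<open>dependent {x, y, z}\<close> is about
  sets and would not register a repeated vector.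
\<close>

definition linearly_dependent3 :: "real^3 \<Rightarrow> real^3 \<Rightarrow> real^3 \<Rightarrow> bool" where
  "linearly_dependent3 x y z \<longleftrightarrow>
     (\<exists>p q r :: real. (p, q, r) \<noteq> (0, 0, 0) \<and> p *\<^sub>R x + q *\<^sub>R y + r *\<^sub>R z = 0)"

definition developable :: "real \<Rightarrow> real \<Rightarrow> ribbon_surface \<Rightarrow> bool" where
  "developable a b f \<longleftrightarrow>
     (\<forall>t\<in>{a..b}. \<forall>i\<in>{0,1}.
        linearly_dependent3 (dot a b f i t) (Delta f i t) (dot a b f (Suc i) t))"

definition isometric_surfaces :: "real \<Rightarrow> real \<Rightarrow> ribbon_surface \<Rightarrow> ribbon_surface \<Rightarrow> bool" where
  "isometric_surfaces a b f g \<longleftrightarrow>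
     (\<forall>t\<in>{a..b}.
        (\<forall>i\<in>{0,1,2}. norm (dot a b f i t) = norm (dot a b g i t)) \<and>
        (\<forall>i\<in>{0,1}. norm (Delta f i t) = norm (Delta g i t)) \<and>
        (\<forall>i\<in>{1,2}. dot a b f i t \<bullet> Delta f (i - 1) t = dot a b g i t \<bullet> Delta g (i - 1) t) \<and>
        (\<forall>i\<in>{0,1}. dot a b f i t \<bullet> Delta f i t = dot a b g i t \<bullet> Delta g i t) \<and>
        (\<forall>i\<in>{0,1}. dot a b f i t \<bullet> dot a b f (Suc i) t = dot a b g i t \<bullet> dot a b g (Suc i) t))"

text \<open>
  A deformation is a family in \<^term>\<open>C121 a b\<close>. Continuous differentiability in the parameter is
  required for each \<open>f\<^sub>i(t)\<close> separately; every curve that is continuously differentiable with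
  respect to the Banach space norm has this property.
\<close>

definition deformation ::
  "real \<Rightarrow> real \<Rightarrow> ribbon_surface \<Rightarrow> real \<Rightarrow> (real \<Rightarrow> ribbon_surface) \<Rightarrow> bool" where
  "deformation a b f \<Lambda> \<gamma> \<longleftrightarrow>
     \<Lambda> > 0 \<and>
     (\<forall>l\<in>{-\<Lambda>..\<Lambda>}. \<gamma> l \<in> C121 a b) \<and>
     (\<forall>i\<in>{0,1,2}. \<forall>t\<in>{a..b}. \<gamma> 0 i t = f i t) \<and>
     (\<forall>i\<in>{0,1,2}. \<forall>t\<in>{a..b}. Ck_on 1 {-\<Lambda>..\<Lambda>} (\<lambda>l. \<gamma> l i t))"

definition isometric_deformation ::
  "real \<Rightarrow> real \<Rightarrow> ribbon_surface \<Rightarrow> real \<Rightarrow> (real \<Rightarrow> ribbon_surface) \<Rightarrow> bool" where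
  "isometric_deformation a b f \<Lambda> \<gamma> \<longleftrightarrow>
     deformation a b f \<Lambda> \<gamma> \<and>
     (\<forall>l\<in>{-\<Lambda>..\<Lambda>}. \<forall>m\<in>{-\<Lambda>..\<Lambda>}. isometric_surfaces a b (\<gamma> l) (\<gamma> m))"

definition vector_angle :: "real^3 \<Rightarrow> real^3 \<Rightarrow> real" where
  "vector_angle x y = arccos (x \<bullet> y / (norm x * norm y))"

definition ribbon_angle :: "ribbon_surface \<Rightarrow> real \<Rightarrow> real" where
  "ribbon_angle f t = vector_angle (Delta f 0 t) (Delta f 1 t)"

definition depends_linearly_on :: "real set \<Rightarrow> (real \<Rightarrow> real) \<Rightarrow> bool" where
  "depends_linearly_on S h \<longleftrightarrow> (\<exists>c0 c1. \<forall>l\<in>S. h l = c0 + c1 * l)"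

end

theory Submission
  imports Defs
begin

text \<open>
  The norms of \<open>\<Delta>f\<^sub>0\<close> and \<open>\<Delta>f\<^sub>1\<close> are constant along an isometric deformation, so only the scalar
  product \<open>S = \<langle>\<Delta>f\<^sub>0, \<Delta>f\<^sub>1\<rangle>\<close> matters. Weak genericity makes \<open>\<Delta>f\<^sub>i\<close> and \<open>\<partial>f\<^sub>1\<close> linearly independent
  for \<open>i = 0, 1\<close>, writing \<open>\<partial>\<close> for the derivative in \<open>t\<close>. By developability \<open>\<partial>f\<^sub>0\<close> then lies in the
  plane of \<open>\<Delta>f\<^sub>0, \<partial>f\<^sub>1\<close>, and \<open>\<partial>f\<^sub>2\<close> lies in the plane of \<open>\<Delta>f\<^sub>1, \<partial>f\<^sub>1\<close>. The scalar products
  fixed by an isometry are exactly the Gram matrices of these two triples. They determine the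
  coefficients of the two expansions, and they force every isometric surface to satisfy the same
  expansions (\<open>planar_expansion\<close>).

  Differentiating \<open>S\<close> and inserting the expansions gives a scalar equation \<open>\<partial>S = c S + d\<close> whose
  coefficients \<open>c, d\<close> depend on \<open>t\<close> and the metric only, not on the deformation parameter
  (\<open>ribbon_inner_ode\<close>). The difference of two solutions of such an equation solves the homogeneous
  equation, hence \<open>S\<^sub>\<lambda>(t) = S\<^sub>0(t) + E(t) (S\<^sub>\<lambda>(t\<^sub>0) - S\<^sub>0(t\<^sub>0))\<close> with \<open>E\<close> independent of \<open>\<lambda>\<close>
  (\<open>linear_ode_difference\<close>). This affine relation transports linear dependence on \<open>\<lambda>\<close> from \<open>t\<^sub>0\<close> to
  every \<open>t\<close>.
\<close>

text \<open>
  Cramer's rule for the normal equations of \<open>x = \<alpha> u + \<beta> v\<close>, solved for \<open>\<alpha>\<close>. Expressing the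
  coefficient by scalar products makes it visibly a metric quantity, continuous in \<open>x, u, v\<close>.
\<close>

definition gram_coeff :: "'a::real_inner \<Rightarrow> 'a \<Rightarrow> 'a \<Rightarrow> real" where
  "gram_coeff x u v =
     ((x \<bullet> u) * (v \<bullet> v) - (x \<bullet> v) * (u \<bullet> v)) / ((u \<bullet> u) * (v \<bullet> v) - (u \<bullet> v)\<^sup>2)"

lemma gram_det_eq_norm_cross3:
  "(u \<bullet> u) * (v \<bullet> v) - (u \<bullet> v)\<^sup>2 = (norm (cross3 u v))\<^sup>2"
  using norm_cross[of u v] by (simp add: power2_norm_eq_inner)

lemma linearly_dependent3_expansion:
  assumes dep: "linearly_dependent3 x u v" and ind: "cross3 u v \<noteq> 0"
  shows "x = gram_coeff x u v *\<^sub>R u + gram_coeff x v u *\<^sub>R v"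
proof -
  define D where "D = (u \<bullet> u) * (v \<bullet> v) - (u \<bullet> v)\<^sup>2"
  have D: "D \<noteq> 0"
    using ind by (simp add: D_def gram_det_eq_norm_cross3)
  obtain p q r where nz: "(p, q, r) \<noteq> (0, 0, 0)" and rel: "p *\<^sub>R x + q *\<^sub>R u + r *\<^sub>R v = 0"
    using dep unfolding linearly_dependent3_def by blast
  have "p \<noteq> 0"
  proof
    assume "p = 0"
    then have z: "q *\<^sub>R u + r *\<^sub>R v = 0"
      using rel by simp
    have "cross3 (q *\<^sub>R u + r *\<^sub>R v) v = q *\<^sub>R cross3 u v"
      "cross3 u (q *\<^sub>R u + r *\<^sub>R v) = r *\<^sub>R cross3 u v"
      by (simp_all add: cross_add_left cross_add_right cross_mult_left cross_mult_right)
    then have "q = 0" "r = 0"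
      using z ind by auto
    then show False
      using nz \<open>p = 0\<close> by simp
  qed
  define A B where "A = - (q / p)" and "B = - (r / p)"
  have "p *\<^sub>R x = p *\<^sub>R (A *\<^sub>R u + B *\<^sub>R v)"
    using rel \<open>p \<noteq> 0\<close> by (simp add: A_def B_def algebra_simps add_eq_0_iff2)
  then have x: "x = A *\<^sub>R u + B *\<^sub>R v"
    using \<open>p \<noteq> 0\<close> by simp
  have "gram_coeff x u v = A * D / D"
    unfolding gram_coeff_def D_def[symmetric]
    by (simp add: x D_def inner_add_left algebra_simps power2_eq_square inner_commute)
  moreover have "gram_coeff x v u = B * D / D"
    unfolding gram_coeff_def
    by (simp add: x D_def inner_add_left algebra_simps power2_eq_square inner_commute)
  ultimately show ?thesis
    using D x by simp
qed

lemma linearly_dependent3_reverse: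
  assumes "linearly_dependent3 x y z"
  shows "linearly_dependent3 z y x"
proof -
  obtain p q r where "(p, q, r) \<noteq> (0, 0, 0)" "p *\<^sub>R x + q *\<^sub>R y + r *\<^sub>R z = 0"
    using assms unfolding linearly_dependent3_def by blast
  then have "(r, q, p) \<noteq> (0, 0, 0)" "r *\<^sub>R z + q *\<^sub>R y + p *\<^sub>R x = 0"
    by (auto simp: add_ac)
  then show ?thesis
    unfolding linearly_dependent3_def by blast
qed

text \<open>
  That a vector equals a given combination of two others is the vanishing of a norm, which is a
  quadratic form in the coefficients with the Gram matrix as its matrix.
\<close>

lemma gram_transfers_expansion:
  fixes x u v y w z :: "'a::real_inner"
  assumes x: "x = \<alpha> *\<^sub>R u + \<beta> *\<^sub>R v"
    and gram: "x \<bullet> x = y \<bullet> y" "u \<bullet> u = w \<bullet> w" "v \<bullet> v = z \<bullet> z"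
      "x \<bullet> u = y \<bullet> w" "x \<bullet> v = y \<bullet> z" "u \<bullet> v = w \<bullet> z"
  shows "y = \<alpha> *\<^sub>R w + \<beta> *\<^sub>R z"
proof -
  have quad: "(x - \<alpha> *\<^sub>R u - \<beta> *\<^sub>R v) \<bullet> (x - \<alpha> *\<^sub>R u - \<beta> *\<^sub>R v) =
      x \<bullet> x + \<alpha>\<^sup>2 * (u \<bullet> u) + \<beta>\<^sup>2 * (v \<bullet> v) - 2 * \<alpha> * (x \<bullet> u) - 2 * \<beta> * (x \<bullet> v)
      + 2 * \<alpha> * \<beta> * (u \<bullet> v)" for x u v :: 'a
    by (simp add: inner_diff_left inner_diff_right algebra_simps power2_eq_square inner_commute)
  have "(y - \<alpha> *\<^sub>R w - \<beta> *\<^sub>R z) \<bullet> (y - \<alpha> *\<^sub>R w - \<beta> *\<^sub>R z)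
      = (x - \<alpha> *\<^sub>R u - \<beta> *\<^sub>R v) \<bullet> (x - \<alpha> *\<^sub>R u - \<beta> *\<^sub>R v)"
    unfolding quad gram by simp
  then have "y - \<alpha> *\<^sub>R w - \<beta> *\<^sub>R z = 0"
    using x by simp
  then show ?thesis
    by (simp add: algebra_simps)
qed

lemma planar_expansion:
  fixes x u v y w z :: "real^3"
  assumes "linearly_dependent3 x u v" "cross3 u v \<noteq> 0"
    and "x \<bullet> x = y \<bullet> y" "u \<bullet> u = w \<bullet> w" "v \<bullet> v = z \<bullet> z"
      "x \<bullet> u = y \<bullet> w" "x \<bullet> v = y \<bullet> z" "u \<bullet> v = w \<bullet> z"
  shows "y = gram_coeff x u v *\<^sub>R w + gram_coeff x v u *\<^sub>R z"
  by (rule gram_transfers_expansion[OF linearly_dependent3_expansion[OF assms(1,2)] assms(3-)])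

text \<open>
  If \<open>C\<close> is an antiderivative of \<open>c\<close>, the difference of two solutions multiplied by \<open>exp (- C)\<close> has
  derivative zero. The factor \<open>E t = exp (C t - C t\<^sub>0)\<close> is therefore the same for all pairs of
  solutions; the order of quantifiers records this.
\<close>

lemma linear_ode_difference:
  fixes c d :: "real \<Rightarrow> real"
  assumes c: "continuous_on {a..b} c" and t0: "t\<^sub>0 \<in> {a..b}"
  obtains E where "\<And>y z t. \<lbrakk>\<And>s. s \<in> {a..b} \<Longrightarrow>
        (y has_vector_derivative c s * y s + d s) (at s within {a..b});
      \<And>s. s \<in> {a..b} \<Longrightarrow>
        (z has_vector_derivative c s * z s + d s) (at s within {a..b}); t \<in> {a..b}\<rbrakk>
    \<Longrightarrow> y t - z t = E t * (y t\<^sub>0 - z t\<^sub>0)"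
proof -
  define C where "C = (\<lambda>t. integral {a..t} c)"
  have C: "(C has_real_derivative c t) (at t within {a..b})" if "t \<in> {a..b}" for t
    using integral_has_vector_derivative[OF c that]
    by (simp add: C_def has_real_derivative_iff_has_vector_derivative)
  have "y t - z t = exp (C t - C t\<^sub>0) * (y t\<^sub>0 - z t\<^sub>0)"
    if y: "\<And>s. s \<in> {a..b} \<Longrightarrow> (y has_vector_derivative c s * y s + d s) (at s within {a..b})"
      and z: "\<And>s. s \<in> {a..b} \<Longrightarrow> (z has_vector_derivative c s * z s + d s) (at s within {a..b})"
      and t: "t \<in> {a..b}" for y z t
  proof -
    define h where "h = (\<lambda>s. (y s - z s) * exp (- C s))"
    have "(h has_real_derivative 0) (at s within {a..b})" if s: "s \<in> {a..b}" for s
    proof -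
      have "(h has_real_derivative
          (c s * y s + d s - (c s * z s + d s)) * exp (- C s)
          + (exp (- C s) * (- c s)) * (y s - z s)) (at s within {a..b})"
        unfolding h_def
        using y[OF s] z[OF s] C[OF s]
        by (intro derivative_intros) (simp_all add: has_real_derivative_iff_has_vector_derivative)
      then show ?thesis
        by (simp add: algebra_simps)
    qed
    then obtain k where "\<And>s. s \<in> {a..b} \<Longrightarrow> h s = k"
      using has_field_derivative_zero_constant[of "{a..b}" h] by auto
    then have "h t = h t\<^sub>0"
      using t t0 by simp
    then show ?thesis
      by (simp add: h_def exp_diff exp_minus field_simps)
  qed
  then show ?thesis
    by (rule that)
qed

lemma Ck_on_Suc_vector_derivative:
  fixes g :: "real \<Rightarrow> 'a::real_normed_vector"
  assumes "a < b" "Ck_on (Suc k) {a..b} g"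
  shows "t \<in> {a..b} \<Longrightarrow>
      (g has_vector_derivative vector_derivative g (at t within {a..b})) (at t within {a..b})"
    and "continuous_on {a..b} (\<lambda>t. vector_derivative g (at t within {a..b}))"
proof -
  obtain g' where g': "\<And>t. t \<in> {a..b} \<Longrightarrow> (g has_vector_derivative g' t) (at t within {a..b})"
    and k: "Ck_on k {a..b} g'"
    using assms(2) by (simp only: Ck_on.simps) blast
  have cont: "continuous_on {a..b} g'"
  proof (cases k)
    case (Suc n)
    with k obtain g'' where "\<And>t. t \<in> {a..b} \<Longrightarrow> (g' has_vector_derivative g'' t) (at t within {a..b})"
      by (simp only: Ck_on.simps) blast
    then show ?thesis
      by (meson continuous_on_eq_continuous_within has_vector_derivative_continuous)
  qed (use k in simp)
  have eq: "vector_derivative g (at t within {a..b}) = g' t" if "t \<in> {a..b}" for t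
    using vector_derivative_within_cbox[OF \<open>a < b\<close>, of t g "g' t"] g'[OF that] that by simp
  show "t \<in> {a..b} \<Longrightarrow>
      (g has_vector_derivative vector_derivative g (at t within {a..b})) (at t within {a..b})"
    using g' eq by simp
  show "continuous_on {a..b} (\<lambda>t. vector_derivative g (at t within {a..b}))"
    using continuous_on_eq[OF cont eq[symmetric]] .
qed

lemma C121_dot:
  assumes "a < b" "g \<in> C121 a b" "i \<in> {0, 1, 2}"
  shows C121_has_dot: "t \<in> {a..b} \<Longrightarrow> (g i has_vector_derivative dot a b g i t) (at t within {a..b})"
    and C121_continuous_dot: "continuous_on {a..b} (dot a b g i)"
proof -
  have "\<exists>k. Ck_on (Suc k) {a..b} (g i)"
    using assms(2,3) unfolding C121_def One_nat_def numeral_2_eq_2 by blast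
  then obtain k where k: "Ck_on (Suc k) {a..b} (g i)"
    by blast
  show "t \<in> {a..b} \<Longrightarrow> (g i has_vector_derivative dot a b g i t) (at t within {a..b})"
    "continuous_on {a..b} (dot a b g i)"
    using Ck_on_Suc_vector_derivative[OF \<open>a < b\<close> k] unfolding dot_def by auto
qed

lemma C121_continuous:
  assumes "a < b" "g \<in> C121 a b" "i \<in> {0, 1, 2}"
  shows "continuous_on {a..b} (g i)"
  using C121_has_dot[OF assms]
  by (meson continuous_on_eq_continuous_within has_vector_derivative_continuous)

lemma weakly_generic_cross3:
  assumes "weakly_generic a b f" "t \<in> {a..b}" "i \<in> {0, 1}"
  shows "cross3 (Delta f i t) (dot a b f 1 t) \<noteq> 0"
proof -
  have nz: "dot a b f 1 t \<bullet> cross3 (Delta f 0 t) (Delta f 1 t) \<noteq> 0"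
    using assms unfolding weakly_generic_def mixed_product_def by blast
  have "x \<bullet> cross3 y z = cross3 z x \<bullet> y" "x \<bullet> cross3 y z = - (cross3 y x \<bullet> z)" for x y z
    by (simp_all add: cross3_simps)
  then show ?thesis
    using nz assms(3) by (metis inner_zero_left insertE neg_equal_0_iff_equal singletonD)
qed

text \<open>
  The two coefficients below are what remains of \<open>\<langle>\<partial>\<Delta>f\<^sub>0, \<Delta>f\<^sub>1\<rangle> + \<langle>\<Delta>f\<^sub>0, \<partial>\<Delta>f\<^sub>1\<rangle>\<close> once the
  expansions of \<open>\<partial>f\<^sub>0\<close> and \<open>\<partial>f\<^sub>2\<close> are inserted: the factor of \<open>\<langle>\<Delta>f\<^sub>0, \<Delta>f\<^sub>1\<rangle>\<close>, and the terms
  without it.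
\<close>

definition ode_rate :: "real \<Rightarrow> real \<Rightarrow> ribbon_surface \<Rightarrow> real \<Rightarrow> real" where
  "ode_rate a b f t =
     gram_coeff (dot a b f 2 t) (Delta f 1 t) (dot a b f 1 t)
     - gram_coeff (dot a b f 0 t) (Delta f 0 t) (dot a b f 1 t)"

definition ode_source :: "real \<Rightarrow> real \<Rightarrow> ribbon_surface \<Rightarrow> real \<Rightarrow> real" where
  "ode_source a b f t =
     (1 - gram_coeff (dot a b f 0 t) (dot a b f 1 t) (Delta f 0 t))
       * (dot a b f 1 t \<bullet> Delta f 1 t)
     + (gram_coeff (dot a b f 2 t) (dot a b f 1 t) (Delta f 1 t) - 1)
       * (dot a b f 1 t \<bullet> Delta f 0 t)"

lemma continuous_on_ode_rate:
  assumes "a < b" "f \<in> C121 a b" "weakly_generic a b f"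
  shows "continuous_on {a..b} (ode_rate a b f)"
proof -
  have D: "continuous_on {a..b} (Delta f i)" if "i \<in> {0, 1}" for i
    unfolding Delta_def using that C121_continuous[OF assms(1,2)]
    by (intro continuous_intros) (auto simp: numeral_2_eq_2)
  have nz: "(Delta f i t \<bullet> Delta f i t) * (dot a b f 1 t \<bullet> dot a b f 1 t)
      - (Delta f i t \<bullet> dot a b f 1 t)\<^sup>2 \<noteq> 0" if "t \<in> {a..b}" "i \<in> {0, 1}" for i t
    using weakly_generic_cross3[OF assms(3) that] by (simp add: gram_det_eq_norm_cross3)
  show ?thesis
    unfolding ode_rate_def gram_coeff_def
    using nz by (intro continuous_intros D C121_continuous_dot assms) auto
qed

text \<open>
  The coefficients come from \<open>f\<close>, the solution from an arbitrary surface \<open>g\<close> isometric to \<open>f\<close>: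
  in \<open>\<langle>\<partial>\<Delta>g\<^sub>0, \<Delta>g\<^sub>1\<rangle> + \<langle>\<Delta>g\<^sub>0, \<partial>\<Delta>g\<^sub>1\<rangle>\<close> the expansions of \<open>\<partial>g\<^sub>0\<close> and \<open>\<partial>g\<^sub>2\<close> leave
  \<open>\<langle>\<Delta>g\<^sub>0, \<Delta>g\<^sub>1\<rangle>\<close> as the only scalar product that an isometry does not fix.
\<close>

lemma ribbon_inner_ode:
  assumes ab: "a < b" and g: "g \<in> C121 a b"
    and wg: "weakly_generic a b f" and dev: "developable a b f"
    and iso: "isometric_surfaces a b f g" and t: "t \<in> {a..b}"
  shows "((\<lambda>s. Delta g 0 s \<bullet> Delta g 1 s) has_vector_derivative
      ode_rate a b f t * (Delta g 0 t \<bullet> Delta g 1 t) + ode_source a b f t) (at t within {a..b})"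
proof -
  let ?df = "\<lambda>i. dot a b f i t" and ?dg = "\<lambda>i. dot a b g i t"
  let ?Df = "\<lambda>i. Delta f i t" and ?Dg = "\<lambda>i. Delta g i t"
  have norms: "?df i \<bullet> ?df i = ?dg i \<bullet> ?dg i" if "i \<in> {0, 1, 2}" for i
    using iso t that unfolding isometric_surfaces_def power2_norm_eq_inner[symmetric] by metis
  have Norms: "?Df i \<bullet> ?Df i = ?Dg i \<bullet> ?Dg i" if "i \<in> {0, 1}" for i
    using iso t that unfolding isometric_surfaces_def power2_norm_eq_inner[symmetric] by metis
  have mixed: "?df 1 \<bullet> ?Df 0 = ?dg 1 \<bullet> ?Dg 0" "?df 2 \<bullet> ?Df 1 = ?dg 2 \<bullet> ?Dg 1"
    "?df 0 \<bullet> ?Df 0 = ?dg 0 \<bullet> ?Dg 0" "?df 1 \<bullet> ?Df 1 = ?dg 1 \<bullet> ?Dg 1"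
    "?df 0 \<bullet> ?df 1 = ?dg 0 \<bullet> ?dg 1" "?df 1 \<bullet> ?df 2 = ?dg 1 \<bullet> ?dg 2"
    using iso t unfolding isometric_surfaces_def by (auto simp: numeral_2_eq_2)
  have dep0: "linearly_dependent3 (?df 0) (?Df 0) (?df 1)"
    using dev t unfolding developable_def by auto
  have "linearly_dependent3 (?df 1) (?Df 1) (?df 2)"
    using dev t unfolding developable_def by (auto simp: numeral_2_eq_2)
  then have dep2: "linearly_dependent3 (?df 2) (?Df 1) (?df 1)"
    by (rule linearly_dependent3_reverse)
  have exp0: "?dg 0 = gram_coeff (?df 0) (?Df 0) (?df 1) *\<^sub>R ?Dg 0
      + gram_coeff (?df 0) (?df 1) (?Df 0) *\<^sub>R ?dg 1"
    by (rule planar_expansion[OF dep0 weakly_generic_cross3[OF wg t]])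
      (use norms Norms mixed in \<open>auto simp: inner_commute\<close>)
  have exp2: "?dg 2 = gram_coeff (?df 2) (?Df 1) (?df 1) *\<^sub>R ?Dg 1
      + gram_coeff (?df 2) (?df 1) (?Df 1) *\<^sub>R ?dg 1"
    by (rule planar_expansion[OF dep2 weakly_generic_cross3[OF wg t]])
      (use norms Norms mixed in \<open>auto simp: inner_commute\<close>)
  have "(Delta g 0 has_vector_derivative ?dg 1 - ?dg 0) (at t within {a..b})"
    "(Delta g 1 has_vector_derivative ?dg 2 - ?dg 1) (at t within {a..b})"
    unfolding Delta_def using C121_has_dot[OF ab g _ t]
    by (auto intro!: derivative_intros simp: numeral_2_eq_2)
  then have "((\<lambda>s. Delta g 0 s \<bullet> Delta g 1 s) has_vector_derivative
      ?Dg 0 \<bullet> (?dg 2 - ?dg 1) + (?dg 1 - ?dg 0) \<bullet> ?Dg 1) (at t within {a..b})"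
    by (rule bounded_bilinear.has_vector_derivative[OF bounded_bilinear_inner])
  also have "?Dg 0 \<bullet> (?dg 2 - ?dg 1) + (?dg 1 - ?dg 0) \<bullet> ?Dg 1
      = ode_rate a b f t * (?Dg 0 \<bullet> ?Dg 1) + ode_source a b f t"
    unfolding ode_rate_def ode_source_def mixed exp0 exp2
    by (simp add: inner_add_left inner_add_right inner_diff_left inner_diff_right
        inner_commute algebra_simps)
  finally show ?thesis .
qed

lemma cos_ribbon_angle:
  "cos (ribbon_angle g t) =
     (Delta g 0 t \<bullet> Delta g 1 t) / (norm (Delta g 0 t) * norm (Delta g 1 t))"
proof -
  have "\<bar>x \<bullet> y / (norm x * norm y)\<bar> \<le> 1" for x y :: "real^3"
  proof (cases "x = 0 \<or> y = 0")
    \<comment> \<open>for a zero vector the quotient is \<open>0\<close> by convention, which \<open>arccos\<close> also inverts\<close>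
    case False
    then show ?thesis
      using Cauchy_Schwarz_ineq2[of x y] by (simp add: divide_le_eq_1)
  qed auto
  then show ?thesis
    by (simp add: ribbon_angle_def vector_angle_def cos_arccos_abs)
qed

lemma isometric_surfaces_cong_left:
  assumes "isometric_surfaces a b h g"
    and eq: "\<And>i t. i \<in> {0, 1, 2} \<Longrightarrow> t \<in> {a..b} \<Longrightarrow> h i t = f i t"
  shows "isometric_surfaces a b f g"
proof -
  have "dot a b h i t = dot a b f i t" if "i \<in> {0, 1, 2}" "t \<in> {a..b}" for i t
  proof -
    have "(h i has_vector_derivative v) (at t within {a..b})
        \<longleftrightarrow> (f i has_vector_derivative v) (at t within {a..b})" for v
      using has_vector_derivative_transform[of t "{a..b}" "h i" "f i" v]
        has_vector_derivative_transform[of t "{a..b}" "f i" "h i" v] eq that by auto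
    then show ?thesis
      unfolding dot_def vector_derivative_def by simp
  qed
  moreover have "Delta h i t = Delta f i t" if "i \<in> {0, 1}" "t \<in> {a..b}" for i t
    using that eq by (auto simp: Delta_def numeral_2_eq_2)
  ultimately show ?thesis
    using assms(1) unfolding isometric_surfaces_def by (simp add: numeral_2_eq_2)
qed

theorem corollary5p2:
  fixes a b \<Lambda> t\<^sub>0 :: real
    and f :: ribbon_surface
    and \<gamma> :: "real \<Rightarrow> ribbon_surface"
  assumes "a < b"
    and "f \<in> C121 a b"
    and "weakly_generic a b f"
    and "developable a b f"
    and "isometric_deformation a b f \<Lambda> \<gamma>"
    and "t\<^sub>0 \<in> {a..b}"
    and "depends_linearly_on {-\<Lambda>..\<Lambda>} (\<lambda>l. cos (ribbon_angle (\<gamma> l) t\<^sub>0))"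
  shows "\<forall>t\<in>{a..b}. depends_linearly_on {-\<Lambda>..\<Lambda>} (\<lambda>l. cos (ribbon_angle (\<gamma> l) t))"
proof
  fix t assume t: "t \<in> {a..b}"
  let ?S = "\<lambda>g s. Delta g 0 s \<bullet> Delta g 1 s"
  let ?N = "\<lambda>s. norm (Delta f 0 s) * norm (Delta f 1 s)"
  have def: "deformation a b f \<Lambda> \<gamma>"
    and iso\<gamma>: "\<And>l m. l \<in> {-\<Lambda>..\<Lambda>} \<Longrightarrow> m \<in> {-\<Lambda>..\<Lambda>} \<Longrightarrow> isometric_surfaces a b (\<gamma> l) (\<gamma> m)"
    using assms(5) unfolding isometric_deformation_def by auto
  have \<gamma>: "\<gamma> l \<in> C121 a b" if "l \<in> {-\<Lambda>..\<Lambda>}" for l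
    using def that unfolding deformation_def by blast
  have \<gamma>0: "\<And>i s. i \<in> {0, 1, 2} \<Longrightarrow> s \<in> {a..b} \<Longrightarrow> \<gamma> 0 i s = f i s"
    and "0 \<in> {-\<Lambda>..\<Lambda>}"
    using def unfolding deformation_def by auto
  then have iso: "isometric_surfaces a b f (\<gamma> l)" if "l \<in> {-\<Lambda>..\<Lambda>}" for l
    using isometric_surfaces_cong_left[OF iso\<gamma>[OF _ that]] by blast
  have "isometric_surfaces a b f f"
    unfolding isometric_surfaces_def by simp
  note ode_f = ribbon_inner_ode[OF assms(1,2,3,4) this]
  note ode_\<gamma> = ribbon_inner_ode[OF assms(1) \<gamma> assms(3,4) iso]
  obtain E where E: "\<And>y z t. \<lbrakk>\<And>s. s \<in> {a..b} \<Longrightarrow>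
        (y has_vector_derivative ode_rate a b f s * y s + ode_source a b f s) (at s within {a..b});
      \<And>s. s \<in> {a..b} \<Longrightarrow>
        (z has_vector_derivative ode_rate a b f s * z s + ode_source a b f s) (at s within {a..b});
      t \<in> {a..b}\<rbrakk> \<Longrightarrow> y t - z t = E t * (y t\<^sub>0 - z t\<^sub>0)"
    using linear_ode_difference[OF continuous_on_ode_rate[OF assms(1,2,3)] assms(6),
        where d = "ode_source a b f"] by blast
  have S: "?S (\<gamma> l) t = ?S f t + E t * (?S (\<gamma> l) t\<^sub>0 - ?S f t\<^sub>0)" if l: "l \<in> {-\<Lambda>..\<Lambda>}" for l
    using E[of "?S (\<gamma> l)" "?S f" t, OF ode_\<gamma>[OF l l] ode_f t] by simp
  have angle: "cos (ribbon_angle (\<gamma> l) s) = ?S (\<gamma> l) s / ?N s"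
    if "l \<in> {-\<Lambda>..\<Lambda>}" "s \<in> {a..b}" for l s
    using iso[OF that(1)] that(2) by (simp add: cos_ribbon_angle isometric_surfaces_def)
  have N: "?N t\<^sub>0 \<noteq> 0"
    using weakly_generic_cross3[OF assms(3,6), of 0] weakly_generic_cross3[OF assms(3,6), of 1]
    by auto
  obtain c0 c1 where c: "\<And>l. l \<in> {-\<Lambda>..\<Lambda>} \<Longrightarrow> cos (ribbon_angle (\<gamma> l) t\<^sub>0) = c0 + c1 * l"
    using assms(7) unfolding depends_linearly_on_def by blast
  have S0: "?S (\<gamma> l) t\<^sub>0 = ?N t\<^sub>0 * (c0 + c1 * l)" if "l \<in> {-\<Lambda>..\<Lambda>}" for l
    using c[OF that] angle[OF that assms(6)] N by (simp add: field_simps)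
  have "cos (ribbon_angle (\<gamma> l) t) =
      (?S f t + E t * (?N t\<^sub>0 * c0 - ?S f t\<^sub>0)) / ?N t + (E t * ?N t\<^sub>0 * c1 / ?N t) * l"
    if "l \<in> {-\<Lambda>..\<Lambda>}" for l
    unfolding angle[OF that t] S[OF that] S0[OF that]
    by (simp add: add_divide_distrib[symmetric] algebra_simps)
  then show "depends_linearly_on {-\<Lambda>..\<Lambda>} (\<lambda>l. cos (ribbon_angle (\<gamma> l) t))"
    unfolding depends_linearly_on_def by blast
qed

end
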